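(* Let $J$ be an unbounded subinterval of $\mathbb{R}$ and $g:J\to\mathbb{R}$ a locally absolutely continuous function on $J$. Suppose that $g\in L_\infty(J)$, that the derivative $g':J\to\mathbb{R}$ is of locally bounded variation, and that there exist constants $V_J>0$ and $r\in(0,1]$ such that $$\left|\bigvee\nolimits_a^b(g')\right|\le V_J|a-b|^r\quad\text{for any } a,b\in J.$$ Then $g'\in L_\infty(J)$ and $$\|g'\|_{J,\infty}\le \frac{2^{\frac{r}{r+1}}(r+1)}{r^{\frac{r}{r+1}}}\,\|g\|_{J,\infty}^{\frac{r}{r+1}}\,V_J^{\frac{1}{r+1}}.$$
   Context: $\|\cdot\|_{J,\infty}$ is the essential supremum norm on $J$. For $a<b$, $\bigvee_a^b(h)$ denotes the total variation of $h$ on $[a,b]$; for arbitrary $a,b\in J$, $\left|\bigvee_a^b(h)\right|$ is the total variation of $h$ on the closed interval with endpoints $a$ and $b$ (in either order). *)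

theory Defs
  imports "HOL-Analysis.Analysis" "HOL-Probability.Essential_Supremum"
begin

text \<open>Functions on an interval \<open>J\<close> are total functions on \<open>real\<close>; all notions below only look at
  their values on the interval in question.\<close>

definition abs_cont_on_Icc :: "(real \<Rightarrow> real) \<Rightarrow> real \<Rightarrow> real \<Rightarrow> bool" where
  "abs_cont_on_Icc f a b \<longleftrightarrow>
     (\<forall>\<epsilon>>0. \<exists>\<delta>>0. \<forall>(n::nat) (u::nat \<Rightarrow> real) (v::nat \<Rightarrow> real).
        (\<forall>i<n. a \<le> u i \<and> u i \<le> v i \<and> v i \<le> b) \<longrightarrow>
        disjoint_family_on (\<lambda>i. {u i<..<v i}) {..<n} \<longrightarrow>
        (\<Sum>i<n. v i - u i) < \<delta> \<longrightarrow>
        (\<Sum>i<n. \<bar>f (v i) - f (u i)\<bar>) < \<epsilon>)"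

definition locally_abs_cont_on :: "real set \<Rightarrow> (real \<Rightarrow> real) \<Rightarrow> bool" where
  "locally_abs_cont_on J f \<longleftrightarrow> (\<forall>a b. a \<le> b \<longrightarrow> {a..b} \<subseteq> J \<longrightarrow> abs_cont_on_Icc f a b)"

text \<open>Total variation on \<open>{a..b}\<close>, meaningful for \<open>a \<le> b\<close> only (otherwise there are no
  partitions and the supremum is \<open>-\<infinity>\<close>).\<close>

definition total_variation :: "(real \<Rightarrow> real) \<Rightarrow> real \<Rightarrow> real \<Rightarrow> ereal" where
  "total_variation h a b =
     (SUP (n, t) \<in> {(n::nat, t::nat \<Rightarrow> real). t 0 = a \<and> t n = b \<and> mono_on {0..n} t}.
        ereal (\<Sum>i<n. \<bar>h (t (Suc i)) - h (t i)\<bar>))"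

definition locally_bounded_variation_on :: "real set \<Rightarrow> (real \<Rightarrow> real) \<Rightarrow> bool" where
  "locally_bounded_variation_on J h \<longleftrightarrow>
     (\<forall>a b. a \<le> b \<longrightarrow> {a..b} \<subseteq> J \<longrightarrow> total_variation h a b < \<infinity>)"

definition in_Linf :: "real set \<Rightarrow> (real \<Rightarrow> real) \<Rightarrow> bool" where
  "in_Linf J f \<longleftrightarrow>
     f \<in> borel_measurable (lebesgue_on J) \<and> esssup (lebesgue_on J) (\<lambda>x. ereal \<bar>f x\<bar>) < \<infinity>"

text \<open>The real-valued norm is meaningful only under \<open>in_Linf\<close>.\<close>

definition Linf_norm :: "real set \<Rightarrow> (real \<Rightarrow> real) \<Rightarrow> real" where
  "Linf_norm J f = real_of_ereal (esssup (lebesgue_on J) (\<lambda>x. ereal \<bar>f x\<bar>))"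

text \<open>A locally absolutely continuous function need only be differentiable almost everywhere, so
  ``the derivative \<open>g'\<close> on \<open>J\<close>'' is a function on \<open>J\<close> that agrees with the derivative of \<open>g\<close> at
  almost every point of \<open>J\<close>.\<close>

definition ae_derivative_on :: "real set \<Rightarrow> (real \<Rightarrow> real) \<Rightarrow> (real \<Rightarrow> real) \<Rightarrow> bool" where
  "ae_derivative_on J g g' \<longleftrightarrow>
     (AE x in lebesgue_on J. (g has_real_derivative g' x) (at x within J))"

end

theory Submission
  imports Defs
begin

text \<open>
  The variation bound makes \<open>g'\<close> Hoelder continuous, so \<open>g x - g' c * x\<close>, which is locally absolutely
  continuous, has a derivative bounded by \<open>V * t powr r\<close> almost everywhere on an interval of length
  \<open>t\<close> containing \<open>c\<close>. Hence \<open>\<bar>g' c\<bar> * t\<close> is at most \<open>2 * M + V * t powr (r + 1)\<close> with \<open>M\<close> the norm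
  of \<open>g\<close>. As \<open>J\<close> is unbounded, every \<open>t > 0\<close> is available at every \<open>c\<close>, and
  \<open>t powr (r + 1) = 2 * M / (r * V)\<close> gives the stated constant.
\<close>

section \<open>Increments of absolutely continuous functions\<close>

text \<open>A Cousin argument: the gauge shrinks into an open set of small measure at the points of \<open>N\<close>,
  where absolute continuity controls the sum, and follows the derivative at all other points.\<close>

lemma abs_cont_on_Icc_increment_bound:
  assumes ac: "abs_cont_on_Icc f a b" and "a \<le> b" and "0 \<le> C" and "negligible N"
    and deriv: "\<And>x. x \<in> {a..b} - N \<Longrightarrow>
          \<exists>D. (f has_real_derivative D) (at x within {a..b}) \<and> \<bar>D\<bar> \<le> C"
  shows "\<bar>f b - f a\<bar> \<le> C * (b - a)"
proof -
  \<comment> \<open>The summand \<open>e\<close> pays for the intervals tagged in \<open>N\<close>,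
    the slope \<open>C + e\<close> for all others; both slacks vanish at the end.\<close>
  have approx: "\<bar>f b - f a\<bar> \<le> e + (C + e) * (b - a)" if "e > 0" for e
  proof -
    obtain d where "d > 0" and
      d: "\<And>n u v. (\<forall>i<n. a \<le> u i \<and> u i \<le> v i \<and> v i \<le> b) \<Longrightarrow>
            disjoint_family_on (\<lambda>i. {u i<..<v i}) {..<n::nat} \<Longrightarrow>
            (\<Sum>i<n. v i - u i) < d \<Longrightarrow> (\<Sum>i<n. \<bar>f (v i) - f (u i)\<bar>) < e"
      using ac \<open>e > 0\<close> unfolding abs_cont_on_Icc_def by meson
    have "N \<in> lmeasurable" "measure lebesgue N = 0"
      using \<open>negligible N\<close> negligible_iff_measure by blast+
    \<comment> \<open>Outer regularity encloses \<open>N\<close> in an open set of measure below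
      \<open>d\<close>, the threshold that absolute continuity assigns to \<open>e\<close>.\<close>
    then obtain U where U: "open U" "N \<subseteq> U" "U - N \<in> lmeasurable" "emeasure lebesgue (U - N) < ennreal d"
      using sets_lebesgue_outer_open[OF _ \<open>d > 0\<close>] by blast
    have "U = N \<union> (U - N)"
      using U(2) by blast
    then have "U \<in> lmeasurable"
      using fmeasurable.Un[OF \<open>N \<in> lmeasurable\<close> U(3)] by simp
    moreover have "measure lebesgue U \<le> measure lebesgue N + measure lebesgue (U - N)"
      using measure_Un_le[of N lebesgue "U - N"] \<open>U = _\<close> \<open>N \<in> lmeasurable\<close> U(3)
      by (metis fmeasurableD)
    moreover have "measure lebesgue (U - N) < d"
      using U(3,4) \<open>d > 0\<close> by (simp add: emeasure_eq_measure2 ennreal_less_iff)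
    ultimately have U_meas: "U \<in> lmeasurable" "measure lebesgue U < d"
      using \<open>measure lebesgue N = 0\<close> by auto
    \<comment> \<open>Points of \<open>N\<close> get \<open>U\<close>, points of differentiability
      get a ball on which the difference quotient is controlled, and the remaining points lie
      outside \<open>{a..b}\<close> and get the whole line.\<close>
    have "\<exists>G. open G \<and> x \<in> G \<and> (x \<in> N \<longrightarrow> G \<subseteq> U) \<and>
            (x \<in> {a..b} - N \<longrightarrow> (\<forall>y\<in>G \<inter> {a..b}. \<bar>f y - f x\<bar> \<le> (C + e) * \<bar>y - x\<bar>))" for x
    proof (cases "x \<in> {a..b} - N")
      case True
      then obtain D where "(f has_real_derivative D) (at x within {a..b})" "\<bar>D\<bar> \<le> C"
        using deriv by blast
      then have "(f has_derivative (*) D) (at x within {a..b})"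
        by (simp add: has_field_derivative_def)
      then obtain \<rho> where "\<rho> > 0" and
        \<rho>: "\<And>y. y \<in> {a..b} \<Longrightarrow> \<bar>y - x\<bar> < \<rho> \<Longrightarrow> \<bar>f y - f x - D * (y - x)\<bar> \<le> e * \<bar>y - x\<bar>"
        using \<open>e > 0\<close> unfolding has_derivative_within_alt by auto
      have "\<bar>f y - f x\<bar> \<le> (C + e) * \<bar>y - x\<bar>" if "y \<in> {a..b}" "\<bar>y - x\<bar> < \<rho>" for y
      proof -
        have "\<bar>D * (y - x)\<bar> \<le> C * \<bar>y - x\<bar>"
          using \<open>\<bar>D\<bar> \<le> C\<close> by (simp add: abs_mult mult_right_mono)
        then show ?thesis
          using \<rho>[OF that] by (simp add: distrib_right)
      qed
      then have "\<forall>y\<in>ball x \<rho> \<inter> {a..b}. \<bar>f y - f x\<bar> \<le> (C + e) * \<bar>y - x\<bar>"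
        by (auto simp: dist_real_def abs_minus_commute)
      then show ?thesis
        using True \<open>\<rho> > 0\<close> by (intro exI[of _ "ball x \<rho>"]) auto
    next
      case False
      then show ?thesis
        using U by (cases "x \<in> N") (auto intro: exI[of _ U] exI[of _ UNIV])
    qed
    then obtain \<gamma> where \<gamma>: "\<And>x. open (\<gamma> x)" "\<And>x. x \<in> \<gamma> x" "\<And>x. x \<in> N \<Longrightarrow> \<gamma> x \<subseteq> U"
        "\<And>x y. x \<in> {a..b} - N \<Longrightarrow> y \<in> \<gamma> x \<Longrightarrow> y \<in> {a..b} \<Longrightarrow> \<bar>f y - f x\<bar> \<le> (C + e) * \<bar>y - x\<bar>"
      by atomize_elim (metis IntI)
    have "gauge \<gamma>"
      using \<gamma> by (simp add: gauge_def)
    then obtain p where p: "p tagged_division_of {a..b}" and fine: "\<gamma> fine p"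
      using fine_division_exists_real by blast
    have "finite p"
      using p by blast
    have tag: "\<exists>u v. K = {u..v} \<and> u \<le> x \<and> x \<le> v \<and> a \<le> u \<and> v \<le> b \<and> {u..v} \<subseteq> \<gamma> x"
      if xK: "(x, K) \<in> p" for x K
    proof -
      obtain u v where "K = {u..v}"
        using tagged_division_ofD(4)[OF p xK] by auto
      moreover have "x \<in> K" "K \<subseteq> {a..b}" "K \<subseteq> \<gamma> x"
        using tagged_division_ofD(2,3)[OF p xK] fine xK by (auto simp: fine_def)
      ultimately show ?thesis by auto
    qed
    define \<Delta> where "\<Delta> = (\<lambda>(x::real, K). \<bar>f (Sup K) - f (Inf K)\<bar>)"
    define B where "B = {z \<in> p. fst z \<in> N}"
    have "finite B"
      using \<open>finite p\<close> by (simp add: B_def)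
    \<comment> \<open>The intervals tagged in \<open>N\<close> do not overlap and lie in
      \<open>U\<close>, so their total length is below \<open>d\<close>. They are enumerated by
      naturals to fit the definition of absolute continuity.\<close>
    have bad: "sum \<Delta> B < e"
    proof -
      obtain h where h: "bij_betw h {..<card B} B"
        using ex_bij_betw_nat_finite[OF \<open>finite B\<close>] by (auto simp: atLeast0LessThan)
      define u where "u i = Inf (snd (h i))" for i
      define v where "v i = Sup (snd (h i))" for i
      have hB: "h i \<in> B" if "i < card B" for i
        using bij_betwE[OF h] that by blast
      have uv: "snd (h i) = {u i..v i}" "a \<le> u i" "u i \<le> v i" "v i \<le> b" "{u i..v i} \<subseteq> U"
        if "i < card B" for i
      proof -
        obtain x K where xK: "h i = (x, K)" by fastforce
        with hB[OF that] have "(x, K) \<in> p" "x \<in> N"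
          by (auto simp: B_def)
        then show "snd (h i) = {u i..v i}" "a \<le> u i" "u i \<le> v i" "v i \<le> b" "{u i..v i} \<subseteq> U"
          using tag[of x K] \<gamma>(3)[of x] xK by (auto simp: u_def v_def)
      qed
      have disj: "disjoint_family_on (\<lambda>i. {u i<..<v i}) {..<card B}"
      proof (unfold disjoint_family_on_def, intro ballI impI)
        fix i j assume ij: "i \<in> {..<card B}" "j \<in> {..<card B}" "i \<noteq> j"
        then have "h i \<noteq> h j" "h i \<in> p" "h j \<in> p"
          using h hB by (auto simp: bij_betw_def inj_on_def B_def)
        then have "interior (snd (h i)) \<inter> interior (snd (h j)) = {}"
          using tagged_division_ofD(5)[OF p] by (metis prod.collapse)
        then show "{u i<..<v i} \<inter> {u j<..<v j} = {}"
          using uv(1) ij by simp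
      qed
      have "(\<Sum>i<card B. v i - u i) = (\<Sum>i<card B. measure lebesgue {u i<..<v i})"
        using uv(3) by (intro sum.cong) auto
      also have "\<dots> = measure lebesgue (\<Union>i<card B. {u i<..<v i})"
        using disj uv(3) by (intro measure_finite_Union[symmetric]) auto
      also have "\<dots> \<le> measure lebesgue U"
        using uv(5) U_meas by (intro measure_mono_fmeasurable) fastforce+
      finally have "(\<Sum>i<card B. v i - u i) < d"
        using U_meas by simp
      then have "(\<Sum>i<card B. \<bar>f (v i) - f (u i)\<bar>) < e"
        using d uv disj by blast
      moreover have "sum \<Delta> B = (\<Sum>i<card B. \<Delta> (h i))"
        using sum.reindex_bij_betw[OF h, of \<Delta>] by simp
      ultimately show ?thesis
        by (simp add: \<Delta>_def u_def v_def case_prod_beta)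
    qed
    have good: "sum \<Delta> (p - B) \<le> (C + e) * (b - a)"
    proof -
      have "sum \<Delta> (p - B) \<le> (\<Sum>z\<in>p - B. (C + e) * measure lborel (snd z))"
      proof (rule sum_mono)
        fix z assume z: "z \<in> p - B"
        obtain x K where xK: "z = (x, K)" by fastforce
        then obtain u v where uv: "K = {u..v}" "u \<le> x" "x \<le> v" "a \<le> u" "v \<le> b" "{u..v} \<subseteq> \<gamma> x"
          using tag z by blast
        have "x \<in> {a..b} - N"
          using z uv xK by (auto simp: B_def)
        moreover have "u \<in> \<gamma> x" "v \<in> \<gamma> x"
          using uv by auto
        \<comment> \<open>The derivative estimate is available only from the tag \<open>x\<close>;
          as \<open>x\<close> lies between \<open>u\<close> and \<open>v\<close>, the two bounds add
          up to one in \<open>v - u\<close>.\<close>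
        ultimately have "\<bar>f u - f x\<bar> \<le> (C + e) * (x - u)" "\<bar>f v - f x\<bar> \<le> (C + e) * (v - x)"
          using \<gamma>(4)[of x u] \<gamma>(4)[of x v] uv by auto
        then have "\<bar>f v - f u\<bar> \<le> (C + e) * (v - u)"
          by (simp add: algebra_simps)
        then show "\<Delta> z \<le> (C + e) * measure lborel (snd z)"
          using uv xK by (simp add: \<Delta>_def)
      qed
      also have "\<dots> \<le> (\<Sum>z\<in>p. (C + e) * measure lborel (snd z))"
        using \<open>finite p\<close> \<open>e > 0\<close> \<open>0 \<le> C\<close> by (intro sum_mono2) auto
      also have "\<dots> = (C + e) * (b - a)"
        using additive_content_tagged_division[of p a b] p \<open>a \<le> b\<close>
        by (simp add: sum_distrib_left[symmetric] case_prod_beta)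
      finally show ?thesis .
    qed
    have "f b - f a = (\<Sum>(x,K)\<in>p. f (Sup K) - f (Inf K))"
      by (rule additive_tagged_division_1[OF \<open>a \<le> b\<close> p, symmetric])
    also have "\<bar>\<dots>\<bar> \<le> sum \<Delta> p"
      unfolding \<Delta>_def case_prod_beta by (rule sum_abs)
    also have "\<dots> = sum \<Delta> (p - B) + sum \<Delta> B"
      using \<open>finite p\<close> by (intro sum.subset_diff) (auto simp: B_def)
    finally show ?thesis
      using bad good by simp
  qed
  have "\<bar>f b - f a\<bar> \<le> C * (b - a) + \<eta>" if "\<eta> > 0" for \<eta>
  proof -
    \<comment> \<open>This solves \<open>e + e * (b - a) = \<eta>\<close>; the summand
      \<open>1\<close> keeps the denominator positive when \<open>a = b\<close>.\<close>
    define e where "e = \<eta> / (1 + (b - a))"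
    have "e > 0" "e * (1 + (b - a)) = \<eta>"
      using that \<open>a \<le> b\<close> by (auto simp: e_def)
    then show ?thesis
      using approx[of e] by (simp add: algebra_simps)
  qed
  then show ?thesis
    by (rule field_le_epsilon)
qed

section \<open>Stability and continuity of absolutely continuous functions\<close>

text \<open>The linear term adds at most \<open>\<bar>c\<bar>\<close> times the total length of the
  intervals. With \<open>c\<close> a value of the derivative, the increment bound applied to the
  difference becomes a first-order Taylor estimate.\<close>

lemma abs_cont_on_Icc_diff_linear:
  assumes "abs_cont_on_Icc f a b"
  shows "abs_cont_on_Icc (\<lambda>x. f x - c * x) a b"
  unfolding abs_cont_on_Icc_def
proof (intro allI impI)
  fix e :: real assume "e > 0"
  then obtain d where "d > 0" and
    d: "\<And>n u v. (\<forall>i<n. a \<le> u i \<and> u i \<le> v i \<and> v i \<le> b) \<Longrightarrow>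
          disjoint_family_on (\<lambda>i. {u i<..<v i}) {..<n::nat} \<Longrightarrow>
          (\<Sum>i<n. v i - u i) < d \<Longrightarrow> (\<Sum>i<n. \<bar>f (v i) - f (u i)\<bar>) < e / 2"
    using assms half_gt_zero[OF \<open>e > 0\<close>] unfolding abs_cont_on_Icc_def by meson
  \<comment> \<open>The second entry limits the linear term to \<open>e / 2\<close>;
    \<open>\<bar>c\<bar> + 1\<close> instead of \<open>\<bar>c\<bar>\<close> covers
    \<open>c = 0\<close>.\<close>
  define d' where "d' = min d (e / (2 * (\<bar>c\<bar> + 1)))"
  have "d' > 0"
    using \<open>d > 0\<close> \<open>e > 0\<close> by (simp add: d'_def)
  moreover have "(\<Sum>i<n. \<bar>(f (v i) - c * v i) - (f (u i) - c * u i)\<bar>) < e"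
    if uv: "\<forall>i<n. a \<le> u i \<and> u i \<le> v i \<and> v i \<le> b"
      and "disjoint_family_on (\<lambda>i. {u i<..<v i}) {..<n}"
      and small: "(\<Sum>i<n. v i - u i) < d'" for n :: nat and u v
  proof -
    have "(\<Sum>i<n. \<bar>f (v i) - f (u i)\<bar>) < e / 2"
      using d that by (simp add: d'_def)
    moreover have "\<bar>c\<bar> * (\<Sum>i<n. v i - u i) \<le> e / 2"
    proof -
      have nonneg: "0 \<le> (\<Sum>i<n. v i - u i)"
        using uv by (intro sum_nonneg) auto
      have "\<bar>c\<bar> * (\<Sum>i<n. v i - u i) \<le> (\<bar>c\<bar> + 1) * (e / (2 * (\<bar>c\<bar> + 1)))"
        using small nonneg by (intro mult_mono) (auto simp: d'_def)
      also have "\<dots> = e / 2"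
        by (simp add: field_simps)
      finally show ?thesis .
    qed
    moreover have "(\<Sum>i<n. \<bar>(f (v i) - c * v i) - (f (u i) - c * u i)\<bar>)
        \<le> (\<Sum>i<n. \<bar>f (v i) - f (u i)\<bar> + \<bar>c\<bar> * (v i - u i))"
    proof (rule sum_mono)
      fix i assume "i \<in> {..<n}"
      then have "\<bar>c * (v i - u i)\<bar> = \<bar>c\<bar> * (v i - u i)"
        using uv by (simp add: abs_mult)
      moreover have "(f (v i) - c * v i) - (f (u i) - c * u i) = (f (v i) - f (u i)) - c * (v i - u i)"
        by (simp add: algebra_simps)
      ultimately show "\<bar>(f (v i) - c * v i) - (f (u i) - c * u i)\<bar>
          \<le> \<bar>f (v i) - f (u i)\<bar> + \<bar>c\<bar> * (v i - u i)"
        by linarith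
    qed
    ultimately show ?thesis
      by (simp add: sum.distrib sum_distrib_left)
  qed
  ultimately show "\<exists>d>0. \<forall>n u v. (\<forall>i<n. a \<le> u i \<and> u i \<le> v i \<and> v i \<le> b) \<longrightarrow>
      disjoint_family_on (\<lambda>i. {u i<..<v i}) {..<n::nat} \<longrightarrow> (\<Sum>i<n. v i - u i) < d \<longrightarrow>
      (\<Sum>i<n. \<bar>(f (v i) - c * v i) - (f (u i) - c * u i)\<bar>) < e"
    by blast
qed

lemma abs_cont_on_Icc_imp_continuous_on:
  assumes "abs_cont_on_Icc f a b"
  shows "continuous_on {a..b} f"
  unfolding continuous_on_iff
proof (intro ballI allI impI)
  fix x and e :: real assume x: "x \<in> {a..b}" and "e > 0"
  then obtain d where "d > 0" and
    d: "\<And>n u v. (\<forall>i<n. a \<le> u i \<and> u i \<le> v i \<and> v i \<le> b) \<Longrightarrow>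
          disjoint_family_on (\<lambda>i. {u i<..<v i}) {..<n::nat} \<Longrightarrow>
          (\<Sum>i<n. v i - u i) < d \<Longrightarrow> (\<Sum>i<n. \<bar>f (v i) - f (u i)\<bar>) < e"
    using assms unfolding abs_cont_on_Icc_def by meson
  \<comment> \<open>Families consisting of a single interval suffice; \<open>min\<close> and
    \<open>max\<close> put its endpoints in order.\<close>
  have "dist (f y) (f x) < e" if "y \<in> {a..b}" "dist y x < d" for y
    using d[of 1 "\<lambda>_. min x y" "\<lambda>_. max x y"] x that
    by (cases "x \<le> y") (auto simp: disjoint_family_on_def dist_real_def abs_minus_commute)
  with \<open>d > 0\<close> show "\<exists>d>0. \<forall>y\<in>{a..b}. dist y x < d \<longrightarrow> dist (f y) (f x) < e"
    by blast
qed

section \<open>Total variation, null sets and unbounded intervals\<close>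

text \<open>The partition with the single step from \<open>a\<close> to \<open>b\<close> competes in
  the supremum. This is what turns the variation hypothesis into a Hoelder condition.\<close>

lemma abs_diff_le_total_variation:
  assumes "a \<le> b"
  shows "ereal \<bar>h b - h a\<bar> \<le> total_variation h a b"
proof -
  define t where "t = (\<lambda>n::nat. if n = 0 then a else b)"
  have "(1, t) \<in> {(n::nat, t::nat \<Rightarrow> real). t 0 = a \<and> t n = b \<and> mono_on {0..n} t}"
    using assms by (auto simp: t_def mono_on_def)
  then have "(case (1, t) of (n, t) \<Rightarrow> ereal (\<Sum>i<n. \<bar>h (t (Suc i)) - h (t i)\<bar>)) \<le> total_variation h a b"
    unfolding total_variation_def by (rule SUP_upper)
  then show ?thesis
    by (simp add: t_def)
qed

text \<open>Completeness of Lebesgue measure makes the exceptional set itself a null set, not merely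
  a subset of one.\<close>

lemma AE_lebesgue_on_imp_negligible:
  assumes "AE x in lebesgue_on S. P x" and "S \<in> sets lebesgue"
  shows "negligible {x \<in> S. \<not> P x}"
proof -
  have "AE x in lebesgue. x \<in> S \<longrightarrow> P x"
    using assms by (simp add: AE_restrict_space_iff)
  moreover have "{x. \<not> (x \<in> S \<longrightarrow> P x)} = {x \<in> S. \<not> P x}"
    by blast
  ultimately show ?thesis
    by (simp add: completion.AE_iff_null_sets negligible_iff_null_sets)
qed

text \<open>A value above \<open>M\<close> would persist on a nonempty open interval, which would
  then lie in the null set \<open>N\<close>. This turns an essential bound into a pointwise
  one.\<close>

lemma continuous_on_le_off_negligible:
  fixes f :: "real \<Rightarrow> real"
  assumes cont: "continuous_on {a..b} f" and "a < b" and "negligible N"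
    and le: "\<And>x. x \<in> {a..b} - N \<Longrightarrow> f x \<le> M" and c: "c \<in> {a..b}"
  shows "f c \<le> M"
proof (rule ccontr)
  assume "\<not> f c \<le> M"
  then obtain d where "d > 0" and d: "\<And>y. y \<in> {a..b} \<Longrightarrow> dist y c < d \<Longrightarrow> dist (f y) (f c) < f c - M"
    using cont c unfolding continuous_on_iff by (metis diff_gt_0_iff_gt not_le)
  \<comment> \<open>Clipping to \<open>{a..b}\<close> leaves a nonempty open interval even if
    \<open>c\<close> is an endpoint, because \<open>a < b\<close>.\<close>
  have "{max a (c - d)<..<min b (c + d)} \<subseteq> N"
  proof
    fix y assume y: "y \<in> {max a (c - d)<..<min b (c + d)}"
    then have "f y > M"
      using d[of y] by (auto simp: dist_real_def abs_less_iff abs_diff_less_iff)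
    with y le[of y] show "y \<in> N"
      by force
  qed
  then have "negligible {max a (c - d)<..<min b (c + d)}"
    using \<open>negligible N\<close> negligible_subset by blast
  moreover have "max a (c - d) < min b (c + d)"
    using c \<open>a < b\<close> \<open>d > 0\<close> by auto
  ultimately show False
    using open_not_negligible[of "{max a (c - d)<..<min b (c + d)}"]
    by (simp add: dense)
qed

text \<open>An interval without an upper bound contains everything to the right of each of its
  points, and symmetrically on the left. Thus intervals of every length start or end at any given
  point.\<close>

lemma unbounded_interval_ray:
  fixes J :: "real set"
  assumes "is_interval J" and "\<not> bounded J"
  shows "(\<forall>c\<in>J. \<forall>t\<ge>0. c + t \<in> J) \<or> (\<forall>c\<in>J. \<forall>t\<ge>0. c - t \<in> J)"
proof (cases "bdd_above J")
  case False
  have "y \<in> J" if "c \<in> J" "c \<le> y" for c y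
  proof -
    obtain z where "z \<in> J" "y < z"
      using False by (meson bdd_above.I not_le)
    with that assms(1) show ?thesis
      by (meson is_interval_1 less_imp_le)
  qed
  then show ?thesis by simp
next
  case True
  then have "\<not> bdd_below J"
    using assms(2) by (metis bdd_above.unfold bdd_below.unfold
      atLeastAtMost_iff bounded_closed_interval bounded_subset subsetI)
  have "y \<in> J" if "c \<in> J" "y \<le> c" for c y
  proof -
    obtain z where "z \<in> J" "z < y"
      using \<open>\<not> bdd_below J\<close> by (meson bdd_below.I not_le)
    with that assms(1) show ?thesis
      by (meson is_interval_1 less_imp_le)
  qed
  then show ?thesis by simp
qed

section \<open>Optimising the interval length\<close>

text \<open>After division by \<open>t\<close> the right side is
  \<open>2 * A / t + V * t powr r\<close>, which for \<open>A > 0\<close> is minimal at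
  \<open>t powr (r + 1) = 2 * A / (r * V)\<close>. For \<open>A = 0\<close> this point degenerates
  to \<open>0\<close>, hence the case split.\<close>

lemma optimized_step_bound:
  fixes A K V r :: real
  assumes "0 \<le> A" "0 < V" "0 < r"
    and bound: "\<And>t. t > 0 \<Longrightarrow> K * t \<le> 2 * A + V * t powr r * t"
  shows "K \<le> 2 powr (r / (r + 1)) * (r + 1) / r powr (r / (r + 1))
           * A powr (r / (r + 1)) * V powr (1 / (r + 1))"
proof (cases "A = 0")
  case True
  have "K \<le> 0"
  proof (rule ccontr)
    assume "\<not> K \<le> 0"
    then have "K > 0" by simp
    \<comment> \<open>With this \<open>t\<close> the bound reads
      \<open>K * t \<le> K / 2 * t\<close>, which is absurd for \<open>K > 0\<close>.\<close>
    define t where "t = (K / (2 * V)) powr (1 / r)"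
    have "t > 0" "t powr r = K / (2 * V)"
      using \<open>K > 0\<close> assms by (auto simp: t_def powr_powr)
    then show False
      using bound[of t] True \<open>K > 0\<close> assms by simp
  qed
  \<comment> \<open>The claimed bound is \<open>0\<close> here, since
    \<open>0 powr x = 0\<close>.\<close>
  with True show ?thesis by simp
next
  case False
  with \<open>0 \<le> A\<close> have "A > 0" by simp
  \<comment> \<open>At the minimiser \<open>V * t powr r * t\<close> equals \<open>q\<close>, while
    \<open>2 * A = r * q\<close>, so the two terms sum to \<open>(r + 1) * q\<close>.\<close>
  define q where "q = 2 * A / r"
  have "q > 0"
    using \<open>A > 0\<close> assms by (simp add: q_def)
  define t where "t = (q / V) powr (1 / (r + 1))"
  have "t > 0"
    using \<open>q > 0\<close> assms by (simp add: t_def)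
  have "t powr r * t = t powr (r + 1)"
    using \<open>t > 0\<close> by (simp add: powr_add)
  also have "\<dots> = q / V"
    using \<open>q > 0\<close> assms by (simp add: t_def powr_powr)
  finally have "V * t powr r * t = q"
    using assms by (simp add: mult.assoc)
  moreover have "2 * A = r * q"
    using \<open>0 < r\<close> by (simp add: q_def)
  ultimately have "K * t \<le> (r + 1) * q"
    using bound[OF \<open>t > 0\<close>] by (simp add: distrib_right)
  then have "K \<le> (r + 1) * (q / t)"
    using \<open>t > 0\<close> by (simp add: field_simps)
  also have "q / t = q powr (r / (r + 1)) * V powr (1 / (r + 1))"
  proof -
    have "q powr (r / (r + 1)) * q powr (1 / (r + 1)) = q"
      using \<open>q > 0\<close> assms by (simp add: powr_add[symmetric] add_divide_distrib[symmetric])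
    then show ?thesis
      using \<open>q > 0\<close> assms by (simp add: t_def powr_divide field_simps)
  qed
  also have "q powr (r / (r + 1))
      = 2 powr (r / (r + 1)) * A powr (r / (r + 1)) / r powr (r / (r + 1))"
    using \<open>A > 0\<close> assms by (simp add: q_def powr_divide powr_mult)
  finally show ?thesis
    by (simp add: algebra_simps)
qed

section \<open>Consequences of Hoelder continuity\<close>

text \<open>Off \<open>N\<close>, the function \<open>g x - g' c * x\<close> has derivative
  \<open>g' x - g' c\<close>, at most \<open>V * (b - a) powr r\<close> in absolute value because
  \<open>x\<close> and \<open>c\<close> both lie in \<open>{a..b}\<close>. The increment bound then
  applies.\<close>

lemma taylor_bound_of_holder_ae_derivative:
  assumes ac: "abs_cont_on_Icc g a b" and "a \<le> b" "0 \<le> V" "0 \<le> r" and c: "c \<in> {a..b}"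
    and "negligible N"
    and deriv: "\<And>x. x \<in> {a..b} - N \<Longrightarrow> (g has_real_derivative g' x) (at x within {a..b})"
    and holder: "\<And>x. x \<in> {a..b} \<Longrightarrow> \<bar>g' x - g' c\<bar> \<le> V * \<bar>x - c\<bar> powr r"
  shows "\<bar>g b - g a - g' c * (b - a)\<bar> \<le> V * (b - a) powr r * (b - a)"
proof -
  have "\<bar>(g b - g' c * b) - (g a - g' c * a)\<bar> \<le> (V * (b - a) powr r) * (b - a)"
  proof (rule abs_cont_on_Icc_increment_bound[OF abs_cont_on_Icc_diff_linear[OF ac] \<open>a \<le> b\<close> _ \<open>negligible N\<close>])
    show "0 \<le> V * (b - a) powr r"
      using \<open>0 \<le> V\<close> by simp
    fix x assume x: "x \<in> {a..b} - N"
    have "((\<lambda>x. g x - g' c * x) has_real_derivative g' x - g' c) (at x within {a..b})"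
      using deriv[OF x] by (auto intro!: derivative_eq_intros)
    moreover have "\<bar>g' x - g' c\<bar> \<le> V * (b - a) powr r"
    proof -
      have "\<bar>x - c\<bar> powr r \<le> (b - a) powr r"
        using x c \<open>0 \<le> r\<close> by (intro powr_mono2) auto
      then show ?thesis
        using holder[of x] x \<open>0 \<le> V\<close> by (meson DiffD1 mult_left_mono order_trans)
    qed
    ultimately show "\<exists>D. ((\<lambda>x. g x - g' c * x) has_real_derivative D) (at x within {a..b})
        \<and> \<bar>D\<bar> \<le> V * (b - a) powr r"
      by blast
  qed
  then show ?thesis
    by (simp add: algebra_simps)
qed

text \<open>Supplies the measurability of \<open>g'\<close> that membership in
  \<open>in_Linf\<close> demands.\<close>

lemma continuous_on_of_holder:
  fixes h :: "real \<Rightarrow> real"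
  assumes "0 < V" "0 < r"
    and holder: "\<And>x y. x \<in> S \<Longrightarrow> y \<in> S \<Longrightarrow> \<bar>h x - h y\<bar> \<le> V * \<bar>x - y\<bar> powr r"
  shows "continuous_on S h"
  unfolding continuous_on_iff
proof (intro ballI allI impI)
  fix x and e :: real assume "x \<in> S" "e > 0"
  define d where "d = (e / V) powr (1 / r)"
  have "d > 0" and d: "V * d powr r = e"
    using \<open>e > 0\<close> assms(1,2) by (auto simp: d_def powr_powr)
  have "dist (h y) (h x) < e" if "y \<in> S" "dist y x < d" for y
  proof -
    have "\<bar>y - x\<bar> powr r < d powr r"
      using that \<open>0 < r\<close> by (intro powr_less_mono2) (auto simp: dist_real_def)
    then have "V * \<bar>y - x\<bar> powr r < e"
      using d \<open>0 < V\<close> by (metis mult_strict_left_mono)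
    then show ?thesis
      using holder[OF \<open>y \<in> S\<close> \<open>x \<in> S\<close>] by (simp add: dist_real_def)
  qed
  with \<open>d > 0\<close> show "\<exists>d>0. \<forall>y\<in>S. dist y x < d \<longrightarrow> dist (h y) (h x) < e"
    by blast
qed

section \<open>The bound on an unbounded interval\<close>

theorem theorem3:
  fixes J :: "real set" and g g' :: "real \<Rightarrow> real" and V r :: real
  assumes "is_interval J" and "\<not> bounded J"
    and "locally_abs_cont_on J g"
    and "in_Linf J g"
    and "ae_derivative_on J g g'"
    and "locally_bounded_variation_on J g'"
    and "V > 0" and "0 < r" and "r \<le> 1"
    and "\<And>a b. a \<in> J \<Longrightarrow> b \<in> J \<Longrightarrow>
           total_variation g' (min a b) (max a b) \<le> ereal (V * \<bar>a - b\<bar> powr r)"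
  shows "in_Linf J g' \<and>
         Linf_norm J g' \<le> 2 powr (r / (r + 1)) * (r + 1) / r powr (r / (r + 1))
           * Linf_norm J g powr (r / (r + 1)) * V powr (1 / (r + 1))"
proof -
  define E where "E = esssup (lebesgue_on J) (\<lambda>x. ereal \<bar>g x\<bar>)"
  define M where "M = Linf_norm J g"
  define K where "K = 2 powr (r / (r + 1)) * (r + 1) / r powr (r / (r + 1))
           * M powr (r / (r + 1)) * V powr (1 / (r + 1))"
  have J_meas: "J \<in> sets lebesgue"
    using real_interval_borel_measurable[OF \<open>is_interval J\<close>] by simp
  have sub: "{a..b} \<subseteq> J" if "a \<in> J" "b \<in> J" for a b
    using \<open>is_interval J\<close> that unfolding is_interval_1 by (meson atLeastAtMost_iff subsetI)
  have step: "(\<forall>c\<in>J. \<forall>t\<ge>0. c + t \<in> J) \<or> (\<forall>c\<in>J. \<forall>t\<ge>0. c - t \<in> J)"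
    using unbounded_interval_ray assms(1,2) .
  have ac: "abs_cont_on_Icc g a b" if "a \<le> b" "a \<in> J" "b \<in> J" for a b
    using assms(3) sub that by (auto simp: locally_abs_cont_on_def)
  have holder: "\<bar>g' x - g' y\<bar> \<le> V * \<bar>x - y\<bar> powr r" if "x \<in> J" "y \<in> J" for x y
  proof -
    have "ereal \<bar>g' (max x y) - g' (min x y)\<bar> \<le> ereal (V * \<bar>x - y\<bar> powr r)"
      by (rule order_trans[OF abs_diff_le_total_variation assms(10)[OF that]]) auto
    then show ?thesis
      by (auto simp: min_def max_def abs_minus_commute split: if_splits)
  qed
  have g'_meas: "g' \<in> borel_measurable (lebesgue_on J)"
    using continuous_on_of_holder[OF \<open>V > 0\<close> \<open>0 < r\<close> holder] J_meas
    by (rule continuous_imp_measurable_on_sets_lebesgue)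
  define N where "N = {x \<in> J. \<not> (g has_real_derivative g' x) (at x within J)}"
  have "negligible N"
    using assms(5) J_meas unfolding N_def ae_derivative_on_def by (rule AE_lebesgue_on_imp_negligible)
  define N' where "N' = {x \<in> J. \<not> ereal \<bar>g x\<bar> \<le> E}"
  have "negligible N'"
    using esssup_AE J_meas unfolding N'_def E_def by (rule AE_lebesgue_on_imp_negligible)
  have nondeg: "\<exists>a b. a < b \<and> a \<in> J \<and> b \<in> J \<and> c \<in> {a..b}" if "c \<in> J" for c
    using step
  proof
    assume "\<forall>c\<in>J. \<forall>t\<ge>0. c + t \<in> J"
    with that have "c + 1 \<in> J" by auto
    with that show ?thesis by (intro exI[of _ c] exI[of _ "c + 1"]) auto
  next
    assume "\<forall>c\<in>J. \<forall>t\<ge>0. c - t \<in> J"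
    with that have "c - 1 \<in> J" by auto
    with that show ?thesis by (intro exI[of _ "c - 1"] exI[of _ c]) auto
  qed
  obtain c0 where "c0 \<in> J"
    using \<open>\<not> bounded J\<close> by fastforce
  \<comment> \<open>This rests on \<open>J\<close> not being null: on a null set the essential
    supremum would be \<open>-\<infinity>\<close>. Together with finiteness it lets
    \<open>real_of_ereal\<close> be undone, so that \<open>E = ereal M\<close>.\<close>
  have "E \<ge> 0"
  proof -
    obtain a b where ab: "a < b" "a \<in> J" "b \<in> J"
      using nondeg[OF \<open>c0 \<in> J\<close>] by blast
    then have "\<not> negligible {a..b}"
      using negligible_interval(1)[of a b] by simp
    then obtain x where "x \<in> {a..b}" "x \<notin> N'"
      using \<open>negligible N'\<close> negligible_subset by blast
    then have "ereal \<bar>g x\<bar> \<le> E"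
      using sub[OF ab(2,3)] by (auto simp: N'_def)
    then show ?thesis
      by (meson abs_ge_zero ereal_less_eq(5) order_trans)
  qed
  moreover have "E < \<infinity>"
    using assms(4) by (simp add: in_Linf_def E_def)
  ultimately have E: "E = ereal M" and "M \<ge> 0"
    by (cases E; simp add: M_def Linf_norm_def E_def)+
  \<comment> \<open>Continuity of \<open>g\<close> removes the exceptional set \<open>N'\<close>;
    the values at the two interval endpoints used below need a genuine pointwise bound.\<close>
  have g_bound: "\<bar>g c\<bar> \<le> M" if c: "c \<in> J" for c
  proof -
    obtain a b where ab: "a < b" "a \<in> J" "b \<in> J" "c \<in> {a..b}"
      using nondeg[OF c] by blast
    have "continuous_on {a..b} (\<lambda>x. \<bar>g x\<bar>)"
      using abs_cont_on_Icc_imp_continuous_on[OF ac] ab by (intro continuous_intros) auto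
    then show ?thesis
    proof (rule continuous_on_le_off_negligible[OF _ \<open>a < b\<close> \<open>negligible N'\<close>])
      show "\<bar>g x\<bar> \<le> M" if "x \<in> {a..b} - N'" for x
        using that sub[OF ab(2,3)] by (auto simp: N'_def E)
    qed (rule ab(4))
  qed
  \<comment> \<open>The point \<open>c\<close> may be anywhere in \<open>{a..b}\<close>, so the
    estimate serves intervals to the right and to the left of \<open>c\<close> alike.\<close>
  have key: "\<bar>g' c\<bar> * (b - a) \<le> 2 * M + V * (b - a) powr r * (b - a)"
    if ab: "a \<in> J" "b \<in> J" "a < b" and c: "c \<in> {a..b}" for a b c
  proof -
    have abJ: "{a..b} \<subseteq> J"
      using sub ab by blast
    have "\<bar>g b - g a - g' c * (b - a)\<bar> \<le> V * (b - a) powr r * (b - a)"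
    proof (rule taylor_bound_of_holder_ae_derivative[OF ac _ _ _ c \<open>negligible N\<close>])
      show "(g has_real_derivative g' x) (at x within {a..b})" if "x \<in> {a..b} - N" for x
        using that abJ DERIV_subset unfolding N_def by blast
      show "\<bar>g' x - g' c\<bar> \<le> V * \<bar>x - c\<bar> powr r" if "x \<in> {a..b}" for x
        using holder that c abJ by blast
    qed (use ab \<open>V > 0\<close> \<open>0 < r\<close> in auto)
    moreover have "\<bar>g' c * (b - a)\<bar> = \<bar>g' c\<bar> * (b - a)"
      using ab by (simp add: abs_mult)
    ultimately show ?thesis
      using g_bound[OF ab(1)] g_bound[OF ab(2)] by linarith
  qed
  have g'_bound: "\<bar>g' c\<bar> \<le> K" if c: "c \<in> J" for c
    unfolding K_def
  proof (rule optimized_step_bound[OF \<open>M \<ge> 0\<close> \<open>V > 0\<close> \<open>0 < r\<close>])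
    fix t :: real assume "t > 0"
    show "\<bar>g' c\<bar> * t \<le> 2 * M + V * t powr r * t"
      using step
    proof
      assume "\<forall>c\<in>J. \<forall>t\<ge>0. c + t \<in> J"
      with c \<open>t > 0\<close> have "c + t \<in> J" by auto
      then show ?thesis
        using key[of c "c + t" c] c \<open>t > 0\<close> by simp
    next
      assume "\<forall>c\<in>J. \<forall>t\<ge>0. c - t \<in> J"
      with c \<open>t > 0\<close> have "c - t \<in> J" by auto
      then show ?thesis
        using key[of "c - t" c c] c \<open>t > 0\<close> by simp
    qed
  qed
  have "esssup (lebesgue_on J) (\<lambda>x. ereal \<bar>g' x\<bar>) \<le> ereal K"
    using g'_meas g'_bound by (intro esssup_I) (auto intro!: AE_I2)
  \<comment> \<open>Nonnegativity covers the formal case of an essential supremum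
    \<open>-\<infinity>\<close>, which \<open>real_of_ereal\<close> sends to
    \<open>0\<close>.\<close>
  moreover have "K \<ge> 0"
    using g'_bound[OF \<open>c0 \<in> J\<close>] by linarith
  ultimately have "in_Linf J g' \<and> Linf_norm J g' \<le> K"
    using g'_meas unfolding in_Linf_def Linf_norm_def
    by (cases "esssup (lebesgue_on J) (\<lambda>x. ereal \<bar>g' x\<bar>)") auto
  then show ?thesis
    by (simp add: K_def M_def)
qed

end
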